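(* Let $\phi^{n+1}$ be obtained from $\phi^n$ by one time step of the two-dimensional dimensional-splitting upwind-SAV scheme described in the context, with intermediate quantities $\widetilde\phi^{n,q},\widetilde V^{n,q}$ ($1\le q\le N_y$) and $\widehat\phi^{n,p},\widehat V^{n,p}$ ($1\le p\le N_x$). Then, with no restriction on $\Delta t,\Delta x,\Delta y>0$, $$\begin{aligned}\frac{\mathcal{E}^{n+1}-\mathcal{E}^{n}}{\Delta x\Delta y}\le&-\Delta t\sum_{p=1}^{N_x}\sum_{j=1}^{N_y-1}\min\left\{M(\widehat\phi_{p,j}^{n,p},\widehat\phi_{p,j+1}^{n,p}),M(\widehat\phi_{p,j+1}^{n,p},\widehat\phi_{p,j}^{n,p})\right\}\left|\widehat V_{p,j+\frac12}^{n,p}\right|^2\\&-\Delta t\sum_{q=1}^{N_y}\sum_{i=1}^{N_x-1}\min\left\{M(\widetilde\phi_{i,q}^{n,q},\widetilde\phi_{i+1,q}^{n,q}),M(\widetilde\phi_{i+1,q}^{n,q},\widetilde\phi_{i,q}^{n,q})\right\}\left|\widetilde V_{i+\frac12,q}^{n,q}\right|^2\le 0,\end{aligned}$$ where the discrete energy is $$\mathcal{E}^{n}=\Delta x\Delta y\sum_{i=1}^{N_x-1}\sum_{j=1}^{N_y}\frac{\varepsilon^2}{2}\left(\frac{\phi_{i+1,j}^n-\phi_{i,j}^n}{\Delta x}\right)^2+\Delta x\Delta y\sum_{i=1}^{N_x}\sum_{j=1}^{N_y-1}\frac{\varepsilon^2}{2}\left(\frac{\phi_{i,j+1}^n-\phi_{i,j}^n}{\Delta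 y}\right)^2+\Delta x\Delta y\sum_{i=1}^{N_x}\sum_{j=1}^{N_y}F(\phi_{i,j}^n).$$
   Context: Parameters: integers $N_x,N_y\ge2$, cell sizes $\Delta x,\Delta y>0$, time step $\Delta t>0$, interface parameter $\varepsilon>0$, a positive integer $k$. The potential $F:I\to\mathbb{R}$ is the free energy density, differentiable on its domain of definition $I\subseteq\mathbb{R}$, an interval; typical choices are the logarithmic Flory--Huggins potential $F(\phi)=\frac{\theta}{2}[(1+\phi)\ln(1+\phi)+(1-\phi)\ln(1-\phi)]+\frac{\theta_c}{2}(1-\phi^2)$ with $0<\theta<\theta_c$ (differentiable on $I=(-1,1)$), or the polynomial potential $F(\phi)=\frac14(1-\phi^2)^2$ (with $I=\mathbb{R}$). All arrays of cell averages below take values in $I$. Notation: $\chi^+=\max\{\chi,0\}$, $\chi^-=\min\{\chi,0\}$, and $M(\chi_1,\chi_2)=\big[(1+\chi_1)^+(1-\chi_2)^+\big]^k$. For an array $\psi=(\psi_{i,j})_{1\le i\le N_x,1\le j\le N_y}$ the discrete Laplacian with Neumann boundary conditions is $$(\Delta\psi)_{i,j}=\frac{\psi_{i+1,j}-2\psi_{i,j}+\psi_{i-1,j}}{\Delta x^2}+\frac{\psi_{i,j+1}-2\psi_{i,j}+\psi_{i,j-1}}{\Delta y^2},$$ with the convention $\psi_{0,j}:=\psi_{1,j}$, $\psi_{N_x+1,j}:=\psi_{N_x,j}$, $\psi_{i,0}:=\psi_{i,1}$, $\psi_{i,N_y+1}:=\psi_{i,N_y}$. Scheme (one time step from $\phi^n$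 to $\phi^{n+1}$): Step 1 ($x$-direction). Set $\widetilde\phi^{n,0}=\phi^n$. For $q=1,\dots,N_y$ successively, the array $\widetilde\phi^{n,q}$ and the scalar $\widetilde\xi^{n,q}\in\mathbb{R}$ satisfy $$\widetilde\phi_{i,j}^{n,q}-\widetilde\phi_{i,j}^{n,q-1}=\begin{cases}-\frac{\Delta t}{\Delta x}\left(\widetilde J_{i+\frac12,j}^{n,q}-\widetilde J_{i-\frac12,j}^{n,q}\right),& j=q,\\ 0,& j\ne q,\end{cases}$$ $$\widetilde J_{i+\frac12,j}^{n,q}=\left(\widetilde V_{i+\frac12,j}^{n,q}\right)^+M(\widetilde\phi_{i,j}^{n,q},\widetilde\phi_{i+1,j}^{n,q})+\left(\widetilde V_{i+\frac12,j}^{n,q}\right)^-M(\widetilde\phi_{i+1,j}^{n,q},\widetilde\phi_{i,j}^{n,q}),\quad 1\le i\le N_x-1,$$ $$\widetilde V_{i+\frac12,j}^{n,q}=-\frac1{\Delta x}\left(\widetilde\mu_{i+1,j}^{n,q}-\widetilde\mu_{i,j}^{n,q}\right),\qquad \widetilde\mu_{i,j}^{n,q}=-\varepsilon^2(\Delta\widetilde\phi^{n,q})_{i,j}+\widetilde\xi^{n,q}F'(\widetilde\phi_{i,j}^{n,q}),$$ $$\sum_{i=1}^{N_x}\sum_{j=1}^{N_y}\left(F(\widetilde\phi_{i,j}^{n,q})-F(\widetilde\phi_{i,j}^{n,q-1})\right)=\widetilde\xi^{n,q}\sum_{i=1}^{N_x}\sum_{j=1}^{N_y}F'(\widetilde\phi_{i,j}^{n,q})(\widetilde\phi_{i,j}^{n,q}-\widetilde\phi_{i,j}^{n,q-1}),$$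 with no-flux conditions $\widetilde J_{\frac12,j}^{n,q}=\widetilde J_{N_x+\frac12,j}^{n,q}=0$ for all $j$. Step 2 ($y$-direction). Set $\widehat\phi^{n,0}=\widetilde\phi^{n,N_y}$. For $p=1,\dots,N_x$ successively, the array $\widehat\phi^{n,p}$ and the scalar $\widehat\xi^{n,p}\in\mathbb{R}$ satisfy $$\widehat\phi_{i,j}^{n,p}-\widehat\phi_{i,j}^{n,p-1}=\begin{cases}-\frac{\Delta t}{\Delta y}\left(\widehat J_{i,j+\frac12}^{n,p}-\widehat J_{i,j-\frac12}^{n,p}\right),& i=p,\\ 0,& i\ne p,\end{cases}$$ $$\widehat J_{i,j+\frac12}^{n,p}=\left(\widehat V_{i,j+\frac12}^{n,p}\right)^+M(\widehat\phi_{i,j}^{n,p},\widehat\phi_{i,j+1}^{n,p})+\left(\widehat V_{i,j+\frac12}^{n,p}\right)^-M(\widehat\phi_{i,j+1}^{n,p},\widehat\phi_{i,j}^{n,p}),\quad 1\le j\le N_y-1,$$ $$\widehat V_{i,j+\frac12}^{n,p}=-\frac1{\Delta y}\left(\widehat\mu_{i,j+1}^{n,p}-\widehat\mu_{i,j}^{n,p}\right),\qquad \widehat\mu_{i,j}^{n,p}=-\varepsilon^2(\Delta\widehat\phi^{n,p})_{i,j}+\widehat\xi^{n,p}F'(\widehat\phi_{i,j}^{n,p}),$$ $$\sum_{i=1}^{N_x}\sum_{j=1}^{N_y}\left(F(\widehat\phi_{i,j}^{n,p})-F(\widehat\phi_{i,j}^{n,p-1})\right)=\widehat\xi^{n,p}\sum_{i=1}^{N_x}\sum_{j=1}^{N_y}F'(\widehat\phi_{i,j}^{n,p})(\widehat\phi_{i,j}^{n,p}-\widehat\phi_{i,j}^{n,p-1}),$$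 with no-flux conditions $\widehat J_{i,\frac12}^{n,p}=\widehat J_{i,N_y+\frac12}^{n,p}=0$ for all $i$. Finally $\phi^{n+1}=\widehat\phi^{n,N_x}$ and $\xi^{n+1}=\frac{1}{N_x+N_y}\left(\sum_{q=1}^{N_y}\widetilde\xi^{n,q}+\sum_{p=1}^{N_x}\widehat\xi^{n,p}\right)$. *)

theory Defs
  imports "HOL-Analysis.Analysis"
begin

text \<open>
  Cell averages are functions \<open>nat \<Rightarrow> nat \<Rightarrow> real\<close>; only the values at cells
  \<open>(i, j) \<in> {1..Nx} \<times> {1..Ny}\<close> carry meaning, and every condition below is imposed on these cells
  only. Face quantities carry the index of the cell on their lower side: \<open>velocity_x \<dots> i j\<close> and
  \<open>flux_x \<dots> i j\<close> live on the face \<open>(i + 1/2, j)\<close>, and \<open>velocity_y \<dots> i j\<close> and \<open>flux_y \<dots> i j\<close>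
  on the face \<open>(i, j + 1/2)\<close>.
\<close>

definition mobility :: "nat \<Rightarrow> real \<Rightarrow> real \<Rightarrow> real" where
  "mobility k a b = (max (1 + a) 0 * max (1 - b) 0) ^ k"

text \<open>
  Clamping both indices to the grid yields the Neumann ghost values: index \<open>0\<close> is read as \<open>1\<close> and
  \<open>Nx + 1\<close> (respectively \<open>Ny + 1\<close>) as \<open>Nx\<close> (respectively \<open>Ny\<close>).
\<close>

definition neumann_ext :: "nat \<Rightarrow> nat \<Rightarrow> (nat \<Rightarrow> nat \<Rightarrow> real) \<Rightarrow> nat \<Rightarrow> nat \<Rightarrow> real" where
  "neumann_ext Nx Ny \<psi> i j = \<psi> (min (max i 1) Nx) (min (max j 1) Ny)"

definition discrete_laplacian ::
  "nat \<Rightarrow> nat \<Rightarrow> real \<Rightarrow> real \<Rightarrow> (nat \<Rightarrow> nat \<Rightarrow> real) \<Rightarrow> nat \<Rightarrow> nat \<Rightarrow> real" where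
  "discrete_laplacian Nx Ny dx dy \<psi> i j =
     (let g = neumann_ext Nx Ny \<psi> in
       (g (i + 1) j - 2 * g i j + g (i - 1) j) / dx\<^sup>2
       + (g i (j + 1) - 2 * g i j + g i (j - 1)) / dy\<^sup>2)"

definition chem_potential ::
  "nat \<Rightarrow> nat \<Rightarrow> real \<Rightarrow> real \<Rightarrow> real \<Rightarrow> (real \<Rightarrow> real) \<Rightarrow> (nat \<Rightarrow> nat \<Rightarrow> real) \<Rightarrow> real
    \<Rightarrow> nat \<Rightarrow> nat \<Rightarrow> real" where
  "chem_potential Nx Ny dx dy \<epsilon> F' \<phi> \<xi> i j =
     - (\<epsilon>\<^sup>2 * discrete_laplacian Nx Ny dx dy \<phi> i j) + \<xi> * F' (\<phi> i j)"

definition velocity_x ::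
  "nat \<Rightarrow> nat \<Rightarrow> real \<Rightarrow> real \<Rightarrow> real \<Rightarrow> (real \<Rightarrow> real) \<Rightarrow> (nat \<Rightarrow> nat \<Rightarrow> real) \<Rightarrow> real
    \<Rightarrow> nat \<Rightarrow> nat \<Rightarrow> real" where
  "velocity_x Nx Ny dx dy \<epsilon> F' \<phi> \<xi> i j =
     - (1 / dx) * (chem_potential Nx Ny dx dy \<epsilon> F' \<phi> \<xi> (i + 1) j
                   - chem_potential Nx Ny dx dy \<epsilon> F' \<phi> \<xi> i j)"

definition velocity_y ::
  "nat \<Rightarrow> nat \<Rightarrow> real \<Rightarrow> real \<Rightarrow> real \<Rightarrow> (real \<Rightarrow> real) \<Rightarrow> (nat \<Rightarrow> nat \<Rightarrow> real) \<Rightarrow> real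
    \<Rightarrow> nat \<Rightarrow> nat \<Rightarrow> real" where
  "velocity_y Nx Ny dx dy \<epsilon> F' \<phi> \<xi> i j =
     - (1 / dy) * (chem_potential Nx Ny dx dy \<epsilon> F' \<phi> \<xi> i (j + 1)
                   - chem_potential Nx Ny dx dy \<epsilon> F' \<phi> \<xi> i j)"

text \<open>The \<open>else\<close> branches are the no-flux conditions on the boundary faces.\<close>

definition flux_x ::
  "nat \<Rightarrow> nat \<Rightarrow> real \<Rightarrow> real \<Rightarrow> real \<Rightarrow> nat \<Rightarrow> (real \<Rightarrow> real) \<Rightarrow> (nat \<Rightarrow> nat \<Rightarrow> real) \<Rightarrow> real
    \<Rightarrow> nat \<Rightarrow> nat \<Rightarrow> real" where
  "flux_x Nx Ny dx dy \<epsilon> k F' \<phi> \<xi> i j =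
     (if 1 \<le> i \<and> i \<le> Nx - 1
      then max (velocity_x Nx Ny dx dy \<epsilon> F' \<phi> \<xi> i j) 0 * mobility k (\<phi> i j) (\<phi> (i + 1) j)
         + min (velocity_x Nx Ny dx dy \<epsilon> F' \<phi> \<xi> i j) 0 * mobility k (\<phi> (i + 1) j) (\<phi> i j)
      else 0)"

definition flux_y ::
  "nat \<Rightarrow> nat \<Rightarrow> real \<Rightarrow> real \<Rightarrow> real \<Rightarrow> nat \<Rightarrow> (real \<Rightarrow> real) \<Rightarrow> (nat \<Rightarrow> nat \<Rightarrow> real) \<Rightarrow> real
    \<Rightarrow> nat \<Rightarrow> nat \<Rightarrow> real" where
  "flux_y Nx Ny dx dy \<epsilon> k F' \<phi> \<xi> i j =
     (if 1 \<le> j \<and> j \<le> Ny - 1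
      then max (velocity_y Nx Ny dx dy \<epsilon> F' \<phi> \<xi> i j) 0 * mobility k (\<phi> i j) (\<phi> i (j + 1))
         + min (velocity_y Nx Ny dx dy \<epsilon> F' \<phi> \<xi> i j) 0 * mobility k (\<phi> i (j + 1)) (\<phi> i j)
      else 0)"

definition sav_relation ::
  "nat \<Rightarrow> nat \<Rightarrow> (real \<Rightarrow> real) \<Rightarrow> (real \<Rightarrow> real)
    \<Rightarrow> (nat \<Rightarrow> nat \<Rightarrow> real) \<Rightarrow> (nat \<Rightarrow> nat \<Rightarrow> real) \<Rightarrow> real \<Rightarrow> bool" where
  "sav_relation Nx Ny F F' \<phi>old \<phi> \<xi> \<longleftrightarrow>
     (\<Sum>i=1..Nx. \<Sum>j=1..Ny. F (\<phi> i j) - F (\<phi>old i j))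
       = \<xi> * (\<Sum>i=1..Nx. \<Sum>j=1..Ny. F' (\<phi> i j) * (\<phi> i j - \<phi>old i j))"

text \<open>
  One implicit substep: \<open>row_substep\<close> updates the cells \<open>(\<cdot>, q)\<close>, \<open>column_substep\<close> the cells
  \<open>(p, \<cdot>)\<close>. Since the new array occurs on both sides, these are relations between the old array, the
  new array and the new scalar.
\<close>

definition row_substep ::
  "nat \<Rightarrow> nat \<Rightarrow> real \<Rightarrow> real \<Rightarrow> real \<Rightarrow> real \<Rightarrow> nat \<Rightarrow> (real \<Rightarrow> real) \<Rightarrow> (real \<Rightarrow> real) \<Rightarrow> nat
    \<Rightarrow> (nat \<Rightarrow> nat \<Rightarrow> real) \<Rightarrow> (nat \<Rightarrow> nat \<Rightarrow> real) \<Rightarrow> real \<Rightarrow> bool" where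
  "row_substep Nx Ny dx dy dt \<epsilon> k F F' q \<phi>old \<phi> \<xi> \<longleftrightarrow>
     (\<forall>i\<in>{1..Nx}. \<forall>j\<in>{1..Ny}. \<phi> i j - \<phi>old i j =
        (if j = q
         then - (dt / dx) * (flux_x Nx Ny dx dy \<epsilon> k F' \<phi> \<xi> i j
                             - flux_x Nx Ny dx dy \<epsilon> k F' \<phi> \<xi> (i - 1) j)
         else 0))
     \<and> sav_relation Nx Ny F F' \<phi>old \<phi> \<xi>"

definition column_substep ::
  "nat \<Rightarrow> nat \<Rightarrow> real \<Rightarrow> real \<Rightarrow> real \<Rightarrow> real \<Rightarrow> nat \<Rightarrow> (real \<Rightarrow> real) \<Rightarrow> (real \<Rightarrow> real) \<Rightarrow> nat
    \<Rightarrow> (nat \<Rightarrow> nat \<Rightarrow> real) \<Rightarrow> (nat \<Rightarrow> nat \<Rightarrow> real) \<Rightarrow> real \<Rightarrow> bool" where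
  "column_substep Nx Ny dx dy dt \<epsilon> k F F' p \<phi>old \<phi> \<xi> \<longleftrightarrow>
     (\<forall>i\<in>{1..Nx}. \<forall>j\<in>{1..Ny}. \<phi> i j - \<phi>old i j =
        (if i = p
         then - (dt / dy) * (flux_y Nx Ny dx dy \<epsilon> k F' \<phi> \<xi> i j
                             - flux_y Nx Ny dx dy \<epsilon> k F' \<phi> \<xi> i (j - 1))
         else 0))
     \<and> sav_relation Nx Ny F F' \<phi>old \<phi> \<xi>"

definition grid_eq ::
  "nat \<Rightarrow> nat \<Rightarrow> (nat \<Rightarrow> nat \<Rightarrow> real) \<Rightarrow> (nat \<Rightarrow> nat \<Rightarrow> real) \<Rightarrow> bool" where
  "grid_eq Nx Ny \<phi> \<psi> \<longleftrightarrow> (\<forall>i\<in>{1..Nx}. \<forall>j\<in>{1..Ny}. \<phi> i j = \<psi> i j)"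

definition grid_values_in ::
  "nat \<Rightarrow> nat \<Rightarrow> real set \<Rightarrow> (nat \<Rightarrow> nat \<Rightarrow> real) \<Rightarrow> bool" where
  "grid_values_in Nx Ny I \<phi> \<longleftrightarrow> (\<forall>i\<in>{1..Nx}. \<forall>j\<in>{1..Ny}. \<phi> i j \<in> I)"

text \<open>
  A full time step from \<open>\<phi>\<close> to \<open>\<phi>new\<close>, with scalar output \<open>\<xi>new\<close>. The intermediate arrays are
  \<open>\<phi>t 0, \<dots>, \<phi>t Ny\<close> (\<open>x\<close>-direction) and \<open>\<phi>h 0, \<dots>, \<phi>h Nx\<close> (\<open>y\<close>-direction), with scalars
  \<open>\<xi>t 1, \<dots>, \<xi>t Ny\<close> and \<open>\<xi>h 1, \<dots>, \<xi>h Nx\<close>.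
\<close>

definition usav_step ::
  "nat \<Rightarrow> nat \<Rightarrow> real \<Rightarrow> real \<Rightarrow> real \<Rightarrow> real \<Rightarrow> nat \<Rightarrow> real set \<Rightarrow> (real \<Rightarrow> real) \<Rightarrow> (real \<Rightarrow> real)
    \<Rightarrow> (nat \<Rightarrow> nat \<Rightarrow> real)
    \<Rightarrow> (nat \<Rightarrow> nat \<Rightarrow> nat \<Rightarrow> real) \<Rightarrow> (nat \<Rightarrow> real)
    \<Rightarrow> (nat \<Rightarrow> nat \<Rightarrow> nat \<Rightarrow> real) \<Rightarrow> (nat \<Rightarrow> real)
    \<Rightarrow> (nat \<Rightarrow> nat \<Rightarrow> real) \<Rightarrow> real \<Rightarrow> bool" where
  "usav_step Nx Ny dx dy dt \<epsilon> k I F F' \<phi> \<phi>t \<xi>t \<phi>h \<xi>h \<phi>new \<xi>new \<longleftrightarrow>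
     grid_values_in Nx Ny I \<phi>
     \<and> (\<forall>q\<in>{0..Ny}. grid_values_in Nx Ny I (\<phi>t q))
     \<and> (\<forall>p\<in>{0..Nx}. grid_values_in Nx Ny I (\<phi>h p))
     \<and> grid_eq Nx Ny (\<phi>t 0) \<phi>
     \<and> (\<forall>q\<in>{1..Ny}. row_substep Nx Ny dx dy dt \<epsilon> k F F' q (\<phi>t (q - 1)) (\<phi>t q) (\<xi>t q))
     \<and> grid_eq Nx Ny (\<phi>h 0) (\<phi>t Ny)
     \<and> (\<forall>p\<in>{1..Nx}. column_substep Nx Ny dx dy dt \<epsilon> k F F' p (\<phi>h (p - 1)) (\<phi>h p) (\<xi>h p))
     \<and> grid_eq Nx Ny \<phi>new (\<phi>h Nx)
     \<and> \<xi>new = 1 / (real Nx + real Ny) * ((\<Sum>q=1..Ny. \<xi>t q) + (\<Sum>p=1..Nx. \<xi>h p))"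

definition discrete_energy ::
  "nat \<Rightarrow> nat \<Rightarrow> real \<Rightarrow> real \<Rightarrow> real \<Rightarrow> (real \<Rightarrow> real) \<Rightarrow> (nat \<Rightarrow> nat \<Rightarrow> real) \<Rightarrow> real" where
  "discrete_energy Nx Ny dx dy \<epsilon> F \<phi> =
     dx * dy * (\<Sum>i=1..Nx-1. \<Sum>j=1..Ny. \<epsilon>\<^sup>2 / 2 * ((\<phi> (i + 1) j - \<phi> i j) / dx)\<^sup>2)
     + dx * dy * (\<Sum>i=1..Nx. \<Sum>j=1..Ny-1. \<epsilon>\<^sup>2 / 2 * ((\<phi> i (j + 1) - \<phi> i j) / dy)\<^sup>2)
     + dx * dy * (\<Sum>i=1..Nx. \<Sum>j=1..Ny. F (\<phi> i j))"

end

theory Submission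
  imports Defs
begin

text \<open>
  Each substep dissipates energy. The Dirichlet part of the energy is a convex quadratic and the
  scalar \<open>\<xi>\<close> makes the chain rule exact for the potential part, so the energy increment is at most
  \<open>\<Sum> \<mu> (\<phi> - \<phi>old)\<close>. Summation by parts with the no-flux condition turns this into \<open>- dt \<Sum> J V\<close>,
  and the upwind choice of the mobility gives \<open>J V \<ge> min M M' V\<^sup>2\<close>. Column substeps are row substeps
  of the transposed arrays, and the substeps telescope.
\<close>

text \<open>Abel summation, where both boundary terms carry a factor \<open>b 0\<close> or
  \<open>b N\<close>. It serves twice: with \<open>b\<close> the differences of the Neumann
  extension, and with \<open>b\<close> the fluxes, which vanish on the boundary faces.\<close>

lemma sum_by_parts_zero_boundary:
  fixes a b :: "nat \<Rightarrow> real"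
  assumes "N \<ge> 1" and "b 0 = 0" and "b N = 0"
  shows "(\<Sum>i=1..N. a i * (b i - b (i - 1))) = - (\<Sum>i=1..N-1. b i * (a (i + 1) - a i))"
proof -
  \<comment> \<open>The induction has to keep the boundary terms: \<open>b\<close> vanishes at the
    last index, not at the intermediate ones.\<close>
  have "(\<Sum>i=1..Suc n. a i * (b i - b (i - 1)))
      = a (Suc n) * b (Suc n) - a 1 * b 0 - (\<Sum>i=1..n. b i * (a (i + 1) - a i))" for n
    by (induction n) (simp_all add: algebra_simps)
  from this[of "N - 1"] show ?thesis
    using assms by simp
qed

text \<open>In one dimension \<open>g\<close> plays the role of the Neumann extension of \<open>u\<close>.\<close>

lemma dirichlet_increment_le:
  fixes u v g :: "nat \<Rightarrow> real"
  assumes "N \<ge> 1" and g: "\<And>i. g i = u (min (max i 1) N)"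
  shows "(\<Sum>i=1..N-1. (u (i + 1) - u i)\<^sup>2 / 2) - (\<Sum>i=1..N-1. (v (i + 1) - v i)\<^sup>2 / 2)
     \<le> - (\<Sum>i=1..N. (u i - v i) * (g (i + 1) - 2 * g i + g (i - 1)))"
proof -
  define w where "w i = u i - v i" for i
  define b where "b i = g (i + 1) - g i" for i
  have "(u (i + 1) - u i)\<^sup>2 / 2 - (v (i + 1) - v i)\<^sup>2 / 2 \<le> b i * (w (i + 1) - w i)"
    if "i \<in> {1..N-1}" for i
  proof -
    \<comment> \<open>At an inner face neither clamp acts, so \<open>g\<close> agrees with
      \<open>u\<close> at \<open>i\<close> and \<open>i + 1\<close>.\<close>
    have b: "b i = u (i + 1) - u i"
      using that by (auto simp: b_def g max_def min_def)
    \<comment> \<open>Tangent inequality for the convex function x*x/2; the gap is half the square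
      of \<open>x - y\<close>.\<close>
    have "x\<^sup>2 / 2 - y\<^sup>2 / 2 \<le> x * (x - y)" for x y :: real
      using zero_le_power2[of "x - y"] by (simp add: power2_eq_square algebra_simps)
    from this[of "u (i + 1) - u i" "v (i + 1) - v i"]
    have "(u (i + 1) - u i)\<^sup>2 / 2 - (v (i + 1) - v i)\<^sup>2 / 2
        \<le> (u (i + 1) - u i) * (w (i + 1) - w i)"
      by (simp add: w_def diff_diff_eq2 algebra_simps)
    then show ?thesis by (simp only: b)
  qed
  then have "(\<Sum>i=1..N-1. (u (i + 1) - u i)\<^sup>2 / 2) - (\<Sum>i=1..N-1. (v (i + 1) - v i)\<^sup>2 / 2)
      \<le> (\<Sum>i=1..N-1. b i * (w (i + 1) - w i))"
    by (simp only: sum_subtractf[symmetric] sum_mono)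
  \<comment> \<open>Clamping sends 0 to 1 and \<open>N + 1\<close> to \<open>N\<close>, hence
    \<open>b 0 = 0\<close> and \<open>b N = 0\<close>.\<close>
  also have "\<dots> = - (\<Sum>i=1..N. w i * (b i - b (i - 1)))"
    using sum_by_parts_zero_boundary[of N b w] assms by (simp add: b_def)
  also have "(\<Sum>i=1..N. w i * (b i - b (i - 1)))
      = (\<Sum>i=1..N. (u i - v i) * (g (i + 1) - 2 * g i + g (i - 1)))"
    by (intro sum.cong) (auto simp: b_def w_def)
  finally show ?thesis .
qed

lemma mobility_nonneg: "mobility k a b \<ge> 0"
  by (simp add: mobility_def)

text \<open>The sign of \<open>V\<close> kills one of the two terms, and what remains is the square
  of \<open>V\<close> times one of the two mobilities.\<close>

lemma upwind_flux_ge: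
  fixes V m m' :: real
  shows "min m m' * \<bar>V\<bar>\<^sup>2 \<le> (max V 0 * m + min V 0 * m') * V"
proof (cases "V \<ge> 0")
  case True
  have "min m m' * V\<^sup>2 \<le> m * V\<^sup>2" by (intro mult_right_mono) auto
  with True show ?thesis by (simp add: power2_eq_square mult_ac)
next
  case False
  have "min m m' * V\<^sup>2 \<le> m' * V\<^sup>2" by (intro mult_right_mono) auto
  with False show ?thesis by (simp add: power2_eq_square mult_ac)
qed

text \<open>The discrete energy per cell area. Each gradient sum has its grid lines outermost, so
  that the one-dimensional estimate applies line by line and transposition merely exchanges the two
  sums.\<close>

definition energy_density ::
  "nat \<Rightarrow> nat \<Rightarrow> real \<Rightarrow> real \<Rightarrow> real \<Rightarrow> (real \<Rightarrow> real) \<Rightarrow> (nat \<Rightarrow> nat \<Rightarrow> real) \<Rightarrow> real" where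
  "energy_density Nx Ny dx dy \<epsilon> F \<phi> =
     \<epsilon>\<^sup>2 / dx\<^sup>2 * (\<Sum>j=1..Ny. \<Sum>i=1..Nx-1. (\<phi> (i + 1) j - \<phi> i j)\<^sup>2 / 2)
     + \<epsilon>\<^sup>2 / dy\<^sup>2 * (\<Sum>i=1..Nx. \<Sum>j=1..Ny-1. (\<phi> i (j + 1) - \<phi> i j)\<^sup>2 / 2)
     + (\<Sum>i=1..Nx. \<Sum>j=1..Ny. F (\<phi> i j))"

lemma discrete_energy_eq:
  "discrete_energy Nx Ny dx dy \<epsilon> F \<phi> = dx * dy * energy_density Nx Ny dx dy \<epsilon> F \<phi>"
proof -
  have "(\<Sum>i=1..Nx-1. \<Sum>j=1..Ny. \<epsilon>\<^sup>2 / 2 * ((\<phi> (i + 1) j - \<phi> i j) / dx)\<^sup>2)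
      = \<epsilon>\<^sup>2 / dx\<^sup>2 * (\<Sum>j=1..Ny. \<Sum>i=1..Nx-1. (\<phi> (i + 1) j - \<phi> i j)\<^sup>2 / 2)"
    by (subst sum.swap) (simp add: sum_distrib_left power_divide mult_ac)
  moreover have "(\<Sum>i=1..Nx. \<Sum>j=1..Ny-1. \<epsilon>\<^sup>2 / 2 * ((\<phi> i (j + 1) - \<phi> i j) / dy)\<^sup>2)
      = \<epsilon>\<^sup>2 / dy\<^sup>2 * (\<Sum>i=1..Nx. \<Sum>j=1..Ny-1. (\<phi> i (j + 1) - \<phi> i j)\<^sup>2 / 2)"
    by (simp add: sum_distrib_left power_divide mult_ac)
  ultimately show ?thesis
    unfolding discrete_energy_def energy_density_def by (simp only: distrib_left)
qed

lemma energy_density_cong: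
  assumes "grid_eq Nx Ny \<phi> \<psi>"
  shows "energy_density Nx Ny dx dy \<epsilon> F \<phi> = energy_density Nx Ny dx dy \<epsilon> F \<psi>"
proof -
  have [simp]: "\<phi> i j = \<psi> i j" if "1 \<le> i" "i \<le> Nx" "1 \<le> j" "j \<le> Ny" for i j
    using assms that by (auto simp: grid_eq_def)
  show ?thesis
    unfolding energy_density_def
    by (intro arg_cong2[where f = "(+)"] arg_cong2[where f = "(*)"] refl sum.cong) auto
qed

text \<open>The Dirichlet estimate on every row and every column yields the two parts of the
  Laplacian, and the scalar relation yields the \<open>F'\<close> term; together they form the
  chemical potential. The update formula does not enter yet, so row and column substeps are covered
  alike.\<close>

lemma energy_density_increment_le:
  assumes "Nx \<ge> 1" and "Ny \<ge> 1" and sav: "sav_relation Nx Ny F F' \<psi> \<phi> \<xi>"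
  shows "energy_density Nx Ny dx dy \<epsilon> F \<phi> - energy_density Nx Ny dx dy \<epsilon> F \<psi>
     \<le> (\<Sum>j=1..Ny. \<Sum>i=1..Nx. chem_potential Nx Ny dx dy \<epsilon> F' \<phi> \<xi> i j * (\<phi> i j - \<psi> i j))"
proof -
  define g where "g = neumann_ext Nx Ny \<phi>"
  define w where "w i j = \<phi> i j - \<psi> i j" for i j
  define X where "X i j = w i j * (g (i + 1) j - 2 * g i j + g (i - 1) j)" for i j
  define Y where "Y i j = w i j * (g i (j + 1) - 2 * g i j + g i (j - 1))" for i j
  \<comment> \<open>On a grid row the clamp in \<open>j\<close> does nothing, so \<open>g\<close>
    restricted to that row is the one-dimensional extension.\<close>
  have x: "(\<Sum>i=1..Nx-1. (\<phi> (i + 1) j - \<phi> i j)\<^sup>2 / 2) - (\<Sum>i=1..Nx-1. (\<psi> (i + 1) j - \<psi> i j)\<^sup>2 / 2)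
      \<le> - (\<Sum>i=1..Nx. X i j)" if "j \<in> {1..Ny}" for j
    unfolding X_def w_def using that assms
    by (intro dirichlet_increment_le) (auto simp: g_def neumann_ext_def)
  have y: "(\<Sum>j=1..Ny-1. (\<phi> i (j + 1) - \<phi> i j)\<^sup>2 / 2) - (\<Sum>j=1..Ny-1. (\<psi> i (j + 1) - \<psi> i j)\<^sup>2 / 2)
      \<le> - (\<Sum>j=1..Ny. Y i j)" if "i \<in> {1..Nx}" for i
    unfolding Y_def w_def using that assms
    by (intro dirichlet_increment_le) (auto simp: g_def neumann_ext_def)
  have xs: "(\<Sum>j=1..Ny. \<Sum>i=1..Nx-1. (\<phi> (i + 1) j - \<phi> i j)\<^sup>2 / 2)
      - (\<Sum>j=1..Ny. \<Sum>i=1..Nx-1. (\<psi> (i + 1) j - \<psi> i j)\<^sup>2 / 2) \<le> - (\<Sum>j=1..Ny. \<Sum>i=1..Nx. X i j)"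
    using sum_mono[OF x, of "{1..Ny}"] by (simp add: sum_subtractf sum_negf)
  have ys: "(\<Sum>i=1..Nx. \<Sum>j=1..Ny-1. (\<phi> i (j + 1) - \<phi> i j)\<^sup>2 / 2)
      - (\<Sum>i=1..Nx. \<Sum>j=1..Ny-1. (\<psi> i (j + 1) - \<psi> i j)\<^sup>2 / 2) \<le> - (\<Sum>i=1..Nx. \<Sum>j=1..Ny. Y i j)"
    using sum_mono[OF y, of "{1..Nx}"] by (simp add: sum_subtractf sum_negf)
  have pot: "(\<Sum>i=1..Nx. \<Sum>j=1..Ny. F (\<phi> i j)) - (\<Sum>i=1..Nx. \<Sum>j=1..Ny. F (\<psi> i j))
      = \<xi> * (\<Sum>i=1..Nx. \<Sum>j=1..Ny. F' (\<phi> i j) * w i j)"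
    using sav by (simp add: sav_relation_def sum_subtractf w_def)
  have "energy_density Nx Ny dx dy \<epsilon> F \<phi> - energy_density Nx Ny dx dy \<epsilon> F \<psi>
      \<le> \<epsilon>\<^sup>2 / dx\<^sup>2 * (- (\<Sum>j=1..Ny. \<Sum>i=1..Nx. X i j)) + \<epsilon>\<^sup>2 / dy\<^sup>2 * (- (\<Sum>i=1..Nx. \<Sum>j=1..Ny. Y i j))
        + \<xi> * (\<Sum>i=1..Nx. \<Sum>j=1..Ny. F' (\<phi> i j) * w i j)"
    unfolding energy_density_def pot[symmetric]
    using mult_left_mono[OF xs, of "\<epsilon>\<^sup>2 / dx\<^sup>2"] mult_left_mono[OF ys, of "\<epsilon>\<^sup>2 / dy\<^sup>2"]
    by (simp add: right_diff_distrib)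
  also have "\<dots> = (\<Sum>j=1..Ny. \<Sum>i=1..Nx. - (\<epsilon>\<^sup>2 / dx\<^sup>2 * X i j) - \<epsilon>\<^sup>2 / dy\<^sup>2 * Y i j + \<xi> * (F' (\<phi> i j) * w i j))"
    unfolding sum.swap[of _ "{1..Ny}" "{1..Nx}"]
    by (simp add: sum.distrib sum_subtractf sum_negf sum_distrib_left)
  also have "\<dots> = (\<Sum>j=1..Ny. \<Sum>i=1..Nx. chem_potential Nx Ny dx dy \<epsilon> F' \<phi> \<xi> i j * (\<phi> i j - \<psi> i j))"
    by (intro sum.cong refl)
      (simp add: chem_potential_def discrete_laplacian_def Let_def X_def Y_def g_def w_def
        diff_divide_distrib add_divide_distrib algebra_simps)
  finally show ?thesis .
qed

lemma row_substep_dissipation: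
  assumes "Nx \<ge> 1" and "dx > 0" and "dt > 0" and q: "q \<in> {1..Ny}"
    and step: "row_substep Nx Ny dx dy dt \<epsilon> k F F' q \<psi> \<phi> \<xi>"
  shows "energy_density Nx Ny dx dy \<epsilon> F \<phi> - energy_density Nx Ny dx dy \<epsilon> F \<psi>
     \<le> - dt * (\<Sum>i=1..Nx-1. min (mobility k (\<phi> i q) (\<phi> (i + 1) q)) (mobility k (\<phi> (i + 1) q) (\<phi> i q))
              * \<bar>velocity_x Nx Ny dx dy \<epsilon> F' \<phi> \<xi> i q\<bar>\<^sup>2)"
proof -
  define \<mu> where "\<mu> i = chem_potential Nx Ny dx dy \<epsilon> F' \<phi> \<xi> i q" for i
  define V where "V i = velocity_x Nx Ny dx dy \<epsilon> F' \<phi> \<xi> i q" for i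
  define J where "J i = flux_x Nx Ny dx dy \<epsilon> k F' \<phi> \<xi> i q" for i
  have upd: "\<phi> i j - \<psi> i j = (if j = q then - (dt / dx) * (J i - J (i - 1)) else 0)"
    if "i \<in> {1..Nx}" "j \<in> {1..Ny}" for i j
    using step that by (simp add: row_substep_def J_def)
  have sav: "sav_relation Nx Ny F F' \<psi> \<phi> \<xi>"
    using step by (simp add: row_substep_def)
  have "energy_density Nx Ny dx dy \<epsilon> F \<phi> - energy_density Nx Ny dx dy \<epsilon> F \<psi>
      \<le> (\<Sum>j=1..Ny. \<Sum>i=1..Nx. chem_potential Nx Ny dx dy \<epsilon> F' \<phi> \<xi> i j * (\<phi> i j - \<psi> i j))"
    using energy_density_increment_le[OF _ _ sav] assms by auto
  \<comment> \<open>The increment vanishes off row \<open>q\<close>, which reduces the problem to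
    one dimension.\<close>
  also have "\<dots> = (\<Sum>j=1..Ny. if j = q then \<Sum>i=1..Nx. \<mu> i * (- (dt / dx) * (J i - J (i - 1))) else 0)"
    by (intro sum.cong refl) (simp add: upd \<mu>_def)
  also have "\<dots> = (\<Sum>i=1..Nx. \<mu> i * (- (dt / dx) * (J i - J (i - 1))))"
    using q by simp
  also have "\<dots> = - (dt / dx) * (\<Sum>i=1..Nx. \<mu> i * (J i - J (i - 1)))"
    unfolding sum_distrib_left by (intro sum.cong) auto
  \<comment> \<open>The faces with index 0 and \<open>Nx\<close> are the no-flux boundary faces. The
    minus sign from summation by parts cancels that of the update; the next step regains one from
    the definition of the velocity.\<close>
  also have "\<dots> = dt / dx * (\<Sum>i=1..Nx-1. J i * (\<mu> (i + 1) - \<mu> i))"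
    using assms(1) by (subst sum_by_parts_zero_boundary) (auto simp: J_def flux_x_def)
  also have "\<dots> = - dt * (\<Sum>i=1..Nx-1. J i * V i)"
    unfolding sum_distrib_left by (intro sum.cong) (auto simp: V_def \<mu>_def velocity_x_def)
  \<comment> \<open>The lower bound on \<open>J i * V i\<close> at each face turns into an upper
    bound through the negative factor \<open>- dt\<close>.\<close>
  also have "\<dots> \<le> - dt * (\<Sum>i=1..Nx-1.
      min (mobility k (\<phi> i q) (\<phi> (i + 1) q)) (mobility k (\<phi> (i + 1) q) (\<phi> i q)) * \<bar>V i\<bar>\<^sup>2)"
  proof (intro mult_left_mono_neg sum_mono)
    fix i assume "i \<in> {1..Nx-1}"
    then have "J i = max (V i) 0 * mobility k (\<phi> i q) (\<phi> (i + 1) q)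
        + min (V i) 0 * mobility k (\<phi> (i + 1) q) (\<phi> i q)"
      by (auto simp: J_def V_def flux_x_def)
    then show "min (mobility k (\<phi> i q) (\<phi> (i + 1) q)) (mobility k (\<phi> (i + 1) q) (\<phi> i q)) * \<bar>V i\<bar>\<^sup>2
        \<le> J i * V i"
      by (simp only: upwind_flux_ge)
  qed (use \<open>dt > 0\<close> in simp)
  finally show ?thesis by (simp only: V_def)
qed

lemma energy_density_transpose:
  "energy_density Ny Nx dy dx \<epsilon> F (\<lambda>i j. \<phi> j i) = energy_density Nx Ny dx dy \<epsilon> F \<phi>"
  unfolding energy_density_def by (subst (3) sum.swap) simp

lemma chem_potential_transpose:
  "chem_potential Ny Nx dy dx \<epsilon> F' (\<lambda>i j. \<phi> j i) \<xi> j i = chem_potential Nx Ny dx dy \<epsilon> F' \<phi> \<xi> i j"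
  by (simp add: chem_potential_def discrete_laplacian_def neumann_ext_def Let_def add.commute)

lemma velocity_transpose:
  "velocity_x Ny Nx dy dx \<epsilon> F' (\<lambda>i j. \<phi> j i) \<xi> j i = velocity_y Nx Ny dx dy \<epsilon> F' \<phi> \<xi> i j"
  by (simp add: velocity_x_def velocity_y_def chem_potential_transpose[where \<phi> = \<phi>])

lemma flux_transpose:
  "flux_x Ny Nx dy dx \<epsilon> k F' (\<lambda>i j. \<phi> j i) \<xi> j i = flux_y Nx Ny dx dy \<epsilon> k F' \<phi> \<xi> i j"
  by (simp add: flux_x_def flux_y_def velocity_transpose[where \<phi> = \<phi>])

lemma sav_relation_transpose:
  "sav_relation Ny Nx F F' (\<lambda>i j. \<psi> j i) (\<lambda>i j. \<phi> j i) \<xi> \<longleftrightarrow> sav_relation Nx Ny F F' \<psi> \<phi> \<xi>"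
  unfolding sav_relation_def sum.swap[of _ "{1..Ny}" "{1..Nx}"] ..

text \<open>Once fluxes and the scalar relation are transposed, the two sides differ only in the
  order of the grid quantifiers.\<close>

lemma row_substep_transpose:
  "row_substep Ny Nx dy dx dt \<epsilon> k F F' p (\<lambda>i j. \<psi> j i) (\<lambda>i j. \<phi> j i) \<xi>
     \<longleftrightarrow> column_substep Nx Ny dx dy dt \<epsilon> k F F' p \<psi> \<phi> \<xi>"
  unfolding row_substep_def column_substep_def sav_relation_transpose[where \<phi> = \<phi> and \<psi> = \<psi>]
    flux_transpose[where \<phi> = \<phi>]
  by blast

lemma column_substep_dissipation:
  assumes "Ny \<ge> 1" and "dy > 0" and "dt > 0" and "p \<in> {1..Nx}"
    and "column_substep Nx Ny dx dy dt \<epsilon> k F F' p \<psi> \<phi> \<xi>"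
  shows "energy_density Nx Ny dx dy \<epsilon> F \<phi> - energy_density Nx Ny dx dy \<epsilon> F \<psi>
     \<le> - dt * (\<Sum>j=1..Ny-1. min (mobility k (\<phi> p j) (\<phi> p (j + 1))) (mobility k (\<phi> p (j + 1)) (\<phi> p j))
              * \<bar>velocity_y Nx Ny dx dy \<epsilon> F' \<phi> \<xi> p j\<bar>\<^sup>2)"
  \<comment> \<open>The row estimate is used on the transposed arrays with the roles of x and y
    exchanged, then translated back.\<close>
  using row_substep_dissipation[OF assms(1-4) row_substep_transpose[THEN iffD2, OF assms(5)]]
  unfolding energy_density_transpose[where \<phi> = \<phi>] energy_density_transpose[where \<phi> = \<psi>]
    velocity_transpose[where \<phi> = \<phi>] .

theorem theorem6:
  fixes Nx Ny k :: nat
    and dx dy dt \<epsilon> \<xi>new :: real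
    and I :: "real set"
    and F F' :: "real \<Rightarrow> real"
    and \<phi> \<phi>new :: "nat \<Rightarrow> nat \<Rightarrow> real"
    and \<phi>t \<phi>h :: "nat \<Rightarrow> nat \<Rightarrow> nat \<Rightarrow> real"
    and \<xi>t \<xi>h :: "nat \<Rightarrow> real"
  assumes "Nx \<ge> 2" and "Ny \<ge> 2" and "k \<ge> 1"
    and "dx > 0" and "dy > 0" and "dt > 0" and "\<epsilon> > 0"
    and "is_interval I"
    and "\<And>x. x \<in> I \<Longrightarrow> (F has_real_derivative F' x) (at x within I)"
    and "usav_step Nx Ny dx dy dt \<epsilon> k I F F' \<phi> \<phi>t \<xi>t \<phi>h \<xi>h \<phi>new \<xi>new"
  defines "Vt \<equiv> \<lambda>q. velocity_x Nx Ny dx dy \<epsilon> F' (\<phi>t q) (\<xi>t q)"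
    and "Vh \<equiv> \<lambda>p. velocity_y Nx Ny dx dy \<epsilon> F' (\<phi>h p) (\<xi>h p)"
    and "M \<equiv> mobility k"
  defines "D \<equiv>
      - dt * (\<Sum>p=1..Nx. \<Sum>j=1..Ny-1.
          min (M (\<phi>h p p j) (\<phi>h p p (j + 1))) (M (\<phi>h p p (j + 1)) (\<phi>h p p j))
            * \<bar>Vh p p j\<bar>\<^sup>2)
      - dt * (\<Sum>q=1..Ny. \<Sum>i=1..Nx-1.
          min (M (\<phi>t q i q) (\<phi>t q (i + 1) q)) (M (\<phi>t q (i + 1) q) (\<phi>t q i q))
            * \<bar>Vt q i q\<bar>\<^sup>2)"
  shows "(discrete_energy Nx Ny dx dy \<epsilon> F \<phi>new - discrete_energy Nx Ny dx dy \<epsilon> F \<phi>) / (dx * dy) \<le> D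
    \<and> D \<le> 0"
proof
  define E where "E = energy_density Nx Ny dx dy \<epsilon> F"
  define A where "A p = (\<Sum>j=1..Ny-1.
      min (M (\<phi>h p p j) (\<phi>h p p (j + 1))) (M (\<phi>h p p (j + 1)) (\<phi>h p p j)) * \<bar>Vh p p j\<bar>\<^sup>2)" for p
  define B where "B q = (\<Sum>i=1..Nx-1.
      min (M (\<phi>t q i q) (\<phi>t q (i + 1) q)) (M (\<phi>t q (i + 1) q) (\<phi>t q i q)) * \<bar>Vt q i q\<bar>\<^sup>2)" for q
  have D: "D = - dt * (\<Sum>p=1..Nx. A p) - dt * (\<Sum>q=1..Ny. B q)"
    by (simp add: D_def A_def B_def)
  note step = assms(10)[unfolded usav_step_def]
  have "E (\<phi>t q) - E (\<phi>t (q - 1)) \<le> - dt * B q" if "q \<in> {1..Ny}" for q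
    using row_substep_dissipation[of Nx dx dt q Ny] that step assms(1-6)
    by (simp add: E_def B_def M_def Vt_def)
  then have "(\<Sum>q=1..Ny. E (\<phi>t q) - E (\<phi>t (q - 1))) \<le> - dt * (\<Sum>q=1..Ny. B q)"
    unfolding sum_distrib_left by (rule sum_mono)
  then have t: "E (\<phi>t Ny) - E (\<phi>t 0) \<le> - dt * (\<Sum>q=1..Ny. B q)"
    using sum_telescope''[of 0 Ny "\<lambda>q. E (\<phi>t q)"] by simp
  have "E (\<phi>h p) - E (\<phi>h (p - 1)) \<le> - dt * A p" if "p \<in> {1..Nx}" for p
    using column_substep_dissipation[of Ny dy dt p Nx] that step assms(1-6)
    by (simp add: E_def A_def M_def Vh_def)
  then have "(\<Sum>p=1..Nx. E (\<phi>h p) - E (\<phi>h (p - 1))) \<le> - dt * (\<Sum>p=1..Nx. A p)"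
    unfolding sum_distrib_left by (rule sum_mono)
  then have h: "E (\<phi>h Nx) - E (\<phi>h 0) \<le> - dt * (\<Sum>p=1..Nx. A p)"
    using sum_telescope''[of 0 Nx "\<lambda>p. E (\<phi>h p)"] by simp
  \<comment> \<open>The stages are joined by equality on the grid only, which suffices because the
    energy reads no other cells.\<close>
  have "E (\<phi>t 0) = E \<phi>" "E (\<phi>h 0) = E (\<phi>t Ny)" "E \<phi>new = E (\<phi>h Nx)"
    unfolding E_def using step by (auto intro: energy_density_cong)
  with t h have "E \<phi>new - E \<phi> \<le> D"
    unfolding D by linarith
  then show "(discrete_energy Nx Ny dx dy \<epsilon> F \<phi>new - discrete_energy Nx Ny dx dy \<epsilon> F \<phi>) / (dx * dy) \<le> D"
    using assms(4,5) by (simp add: discrete_energy_eq E_def right_diff_distrib[symmetric])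
  \<comment> \<open>The positive parts in the mobility make every summand nonnegative, even for
    values outside [-1, 1].\<close>
  have "A p \<ge> 0" "B p \<ge> 0" for p
    unfolding A_def B_def M_def by (auto intro!: sum_nonneg mult_nonneg_nonneg mobility_nonneg)
  then have "dt * (\<Sum>p=1..Nx. A p) \<ge> 0" "dt * (\<Sum>q=1..Ny. B q) \<ge> 0"
    using assms(6) by (simp_all add: sum_nonneg)
  then show "D \<le> 0"
    unfolding D by simp
qed

end
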